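(* Let $q\in\{3,4\}$ and $d\ge 1$ be integers, and let $T$ be the complete $q$-ary tree of depth $d$. Then there is some $\varepsilon\in[-1-\log_q(2),\,3]$ such that $\Phi_V(T)=d-\log_q(d)+\varepsilon$.
   Context: The complete $q$-ary tree of depth $d$ is the rooted tree in which every vertex at distance less than $d$ from the root has exactly $q$ children, and the vertices at distance $d$ from the root are leaves. For a graph $G$ and $S\subseteq V(G)$, the vertex-border is $\delta(S)=\{v\in V(G)\setminus S : N(v)\cap S\neq\emptyset\}$. The vertex-isoperimetric parameter is $\Phi_V(G,s)=\min_{S\subseteq V(G),\,|S|=s}|\delta(S)|$, and the vertex-isoperimetric peak is $\Phi_V(G)=\max_{0\le s\le |V(G)|}\Phi_V(G,s)$. *)

theory Defs
  imports Complex_Main "Graph_Theory.Graph_Theory"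
begin

text \<open>
  Finite simple graphs are rendered by the locale \<^locale>\<open>graph\<close>: finite symmetric digraphs
  without loops or parallel arcs, so that an undirected edge is a pair of opposite arcs.
\<close>

definition neighborhood :: "('a, 'b) pre_digraph \<Rightarrow> 'a \<Rightarrow> 'a set" where
  "neighborhood G v = {u. v \<rightarrow>\<^bsub>G\<^esub> u}"

definition vertex_border :: "('a, 'b) pre_digraph \<Rightarrow> 'a set \<Rightarrow> 'a set" where
  "vertex_border G S = {v \<in> verts G - S. neighborhood G v \<inter> S \<noteq> {}}"

definition vertex_isoperimetric :: "('a, 'b) pre_digraph \<Rightarrow> nat \<Rightarrow> nat" where
  "vertex_isoperimetric G s =
     Min ((\<lambda>S. card (vertex_border G S)) ` {S. S \<subseteq> verts G \<and> card S = s})"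

definition vertex_isoperimetric_peak :: "('a, 'b) pre_digraph \<Rightarrow> nat" where
  "vertex_isoperimetric_peak G = Max (vertex_isoperimetric G ` {0..card (verts G)})"

text \<open>
  The predicate \<^const>\<open>tree\<close> of the graph library is not the notion needed here: it forbids directed
  cycles, and in a symmetric digraph every edge, traversed back and forth, is one. We use the
  definition of an undirected tree by unique paths.
\<close>

definition is_tree :: "('a, 'b) pre_digraph \<Rightarrow> bool" where
  "is_tree G \<longleftrightarrow> graph G \<and> verts G \<noteq> {} \<and>
     (\<forall>u \<in> verts G. \<forall>v \<in> verts G. \<exists>!p. pre_digraph.apath G u p v)"

text \<open>Number of edges of a shortest path.\<close>

definition graph_dist :: "('a, 'b) pre_digraph \<Rightarrow> 'a \<Rightarrow> 'a \<Rightarrow> ereal" where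
  "graph_dist G u v = wf_digraph.\<mu> G (\<lambda>_. 1) u v"

definition children :: "('a, 'b) pre_digraph \<Rightarrow> 'a \<Rightarrow> 'a \<Rightarrow> 'a set" where
  "children G r v = {w \<in> neighborhood G v. graph_dist G r w = graph_dist G r v + 1}"

text \<open>
  \<open>complete_tree q d G r\<close>: the graph \<open>G\<close>, rooted at \<open>r\<close>, is the complete \<open>q\<close>-ary tree of depth \<open>d\<close>.
  A leaf is a vertex without children. Since \<open>G\<close> is connected, the last condition
  excludes vertices at distance more than \<open>d\<close>.
\<close>

definition complete_tree :: "nat \<Rightarrow> nat \<Rightarrow> ('a, 'b) pre_digraph \<Rightarrow> 'a \<Rightarrow> bool" where
  "complete_tree q d G r \<longleftrightarrow> is_tree G \<and> r \<in> verts G \<and>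
     (\<forall>v \<in> verts G. graph_dist G r v < ereal (real d) \<longrightarrow> card (children G r v) = q) \<and>
     (\<forall>v \<in> verts G. graph_dist G r v = ereal (real d) \<longrightarrow> children G r v = {})"

end

theory Submission
  imports Defs
begin

text \<open>
  Let \<open>t\<^sub>i = (q\<^sup>i - 1) / (q - 1)\<close> be the size of a complete subtree with \<open>i\<close> levels. A border vertex at
  height \<open>i\<close> with \<open>c\<close> children in \<open>S\<close> contributes \<open>c t\<^sub>i\<close> to \<open>|S|\<close>, and a further \<open>- (q t\<^sub>i + 1)\<close>
  if its parent is in \<open>S\<close>. So \<open>(q - 1) |S|\<close>, up to an error linear in the size of the border, is a sum
  of powers of \<open>q\<close> whose coefficients are bounded by \<open>q\<close> times the number of border vertices at the
  respective height. If the leading base \<open>q\<close> digits of \<open>(q - 1) |S|\<close> are all \<open>1\<close>, the error can only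
  spoil about \<open>log d\<close> of the low positions, and every other height needs a border vertex.

  Conversely, expand \<open>s\<close> greedily in the \<open>t\<^sub>i\<close> and spend one border vertex on each height, from the
  top down to a height of about \<open>log d\<close>. For \<open>q \<le> 4\<close>, choosing whether a border vertex hangs below \<open>S\<close>
  turns at least every second digit into \<open>1\<close> or \<open>q - 1\<close>, and each such place allows the size to be
  decreased, respectively increased, by one at no cost. These linearly many corrections make up for
  the remainder of the expansion: it is either added, or rounded up to the next \<open>t\<^sub>i\<close> and the
  difference is subtracted.
\<close>

subsection \<open>Digit expansions\<close>

definition subtree_size :: "nat \<Rightarrow> nat \<Rightarrow> nat" where
  "subtree_size q i = (\<Sum>j<i. q ^ j)"

lemma subtree_size_0 [simp]: "subtree_size q 0 = 0"
  by (simp add: subtree_size_def)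

lemma subtree_size_Suc: "subtree_size q (Suc i) = q * subtree_size q i + 1"
  unfolding subtree_size_def
  by (subst sum.lessThan_Suc_shift) (simp add: sum_distrib_left)

lemma subtree_size_closed: "(int q - 1) * int (subtree_size q i) = int q ^ i - 1"
  by (induction i) (auto simp: subtree_size_Suc algebra_simps)

lemma subtree_size_pos: "0 < i \<Longrightarrow> 0 < subtree_size q i"
  by (cases i) (auto simp: subtree_size_Suc)

lemma subtree_size_mono: "i \<le> j \<Longrightarrow> subtree_size q i \<le> subtree_size q j"
  unfolding subtree_size_def by (rule sum_mono2) auto

text \<open>The expression \<open>max 0 (max (- e) (e - 1))\<close> is the distance of the carry
  \<open>e\<close> from {0, 1} and acts as a potential. Without payment, dividing by
  \<open>q \<ge> 3\<close> lowers this distance by at least one, and is impossible if it is zero;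
  each unit of \<open>w\<close> moves \<open>e'\<close> by at most one.\<close>

lemma digit_step:
  fixes q :: nat and a e e' :: int and w :: nat
  assumes q: "q \<ge> 3" and a: "\<bar>a\<bar> \<le> int q * int w" and eq: "1 + e = a + int q * e'"
  shows "int w \<ge> 1 + max 0 (max (- e') (e' - 1)) - max 0 (max (- e) (e - 1))"
proof (rule ccontr)
  define D where "D = max 0 (max (- e) (e - 1))"
  assume "\<not> ?thesis"
  then have neg: "int w < 1 + max 0 (max (- e') (e' - 1)) - D" by (simp add: D_def)
  have q3: "int q \<ge> 3" using q by simp
  have D: "0 \<le> D" "- e \<le> D" "e - 1 \<le> D" by (auto simp: D_def)
  show False
  proof (cases "e' \<ge> 1")
    case True
    then have w: "1 + D \<le> e' - int w" using neg by simp
    have "int q * e' - 1 - e \<le> int q * int w" using a eq by linarith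
    then have *: "int q * (e' - int w) \<le> 1 + e" by (simp add: algebra_simps)
    have "3 * (1 + D) \<le> int q * (1 + D)"
      using q3 D by (intro mult_right_mono) auto
    also have "\<dots> \<le> int q * (e' - int w)"
      using w by (intro mult_left_mono) auto
    also note *
    finally show False using D by simp
  next
    case False
    then have w: "e' + int w \<le> - D" using neg by simp
    have "1 + e \<le> int q * (e' + int w)" using a eq by (simp add: algebra_simps)
    also have "int q * (e' + int w) \<le> int q * (- D)"
      using w by (intro mult_left_mono) auto
    finally have "1 + e \<le> int q * (- D)" .
    moreover have "3 * D \<le> int q * D"
      using q3 D by (intro mult_right_mono) auto
    ultimately show False using D by simp
  qed
qed

text \<open>
  Here \<open>w i\<close> is the number of border vertices paying for the digit \<open>A i\<close>. The base \<open>q\<close> digits of a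
  repunit and of its successor stay nonzero after any useful carry, so every position must be paid.
\<close>
lemma digits_weight_ge:
  fixes q :: nat and A :: "nat \<Rightarrow> int" and w :: "nat \<Rightarrow> nat" and e N :: int
  assumes "q \<ge> 3" and "\<And>i. i < m \<Longrightarrow> \<bar>A i\<bar> \<le> int q * int (w i)"
    and "(\<Sum>i<m. A i * int q ^ i) = int (subtree_size q m) + e + N * int q ^ m"
  shows "int (\<Sum>i<m. w i) \<ge> int m - max 0 (max (- e) (e - 1))"
  using assms
proof (induction m arbitrary: A w e)
  case 0
  then show ?case by simp
next
  case (Suc m)
  \<comment> \<open>The carry into the next position: the excess of the higher digits over the
    repunit shortened by one digit, with the overflow \<open>N\<close> removed.\<close>
  define e' where "e' = (\<Sum>i<m. A (Suc i) * int q ^ i) - int (subtree_size q m) - N * int q ^ m"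
  have split: "(\<Sum>i<Suc m. A i * int q ^ i) = A 0 + int q * (\<Sum>i<m. A (Suc i) * int q ^ i)"
    by (subst sum.lessThan_Suc_shift) (simp add: sum_distrib_left mult_ac)
  have "1 + e = A 0 + int q * e'"
    using Suc.prems(3) unfolding split e'_def by (simp add: subtree_size_Suc algebra_simps)
  then have "int (w 0) \<ge> 1 + max 0 (max (- e') (e' - 1)) - max 0 (max (- e) (e - 1))"
    using digit_step[of q "A 0" "w 0" e e'] Suc.prems(1) Suc.prems(2)[of 0] by simp
  moreover have "int (\<Sum>i<m. w (Suc i)) \<ge> int m - max 0 (max (- e') (e' - 1))"
    using Suc.prems by (intro Suc.IH[where A = "\<lambda>i. A (Suc i)"]) (auto simp: e'_def)
  moreover have "(\<Sum>i<Suc m. w i) = w 0 + (\<Sum>i<m. w (Suc i))"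
    by (rule sum.lessThan_Suc_shift)
  ultimately show ?case by simp
qed

lemma low_digits_le:
  fixes q :: nat and A :: "nat \<Rightarrow> int" and w :: "nat \<Rightarrow> nat"
  assumes "q \<ge> 1" and "\<And>i. i < j \<Longrightarrow> \<bar>A i\<bar> \<le> int q * int (w i)"
  shows "\<bar>\<Sum>i<j. A i * int q ^ i\<bar> \<le> int (\<Sum>i<j. w i) * int q ^ j"
proof -
  have "\<bar>A i * int q ^ i\<bar> \<le> int (w i) * int q ^ j" if "i < j" for i
  proof -
    have "\<bar>A i * int q ^ i\<bar> = \<bar>A i\<bar> * int q ^ i" by (simp add: abs_mult)
    also have "\<dots> \<le> int q * int (w i) * int q ^ i"
      using assms(2)[OF that] by (intro mult_right_mono) auto
    also have "\<dots> = int (w i) * int q ^ Suc i" by simp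
    also have "\<dots> \<le> int (w i) * int q ^ j"
      using that assms(1) by (intro mult_left_mono power_increasing) auto
    finally show ?thesis .
  qed
  then have "(\<Sum>i<j. \<bar>A i * int q ^ i\<bar>) \<le> (\<Sum>i<j. int (w i) * int q ^ j)"
    by (intro sum_mono) auto
  then show ?thesis
    using sum_abs[of "\<lambda>i. A i * int q ^ i" "{..<j}"] by (simp add: sum_distrib_right del: sum_abs)
qed

text \<open>The low \<open>j\<close> positions shift the number by at most their own weight
  \<open>u\<close> in units of \<open>q ^ j\<close>. So \<open>e\<close> is within \<open>u\<close>
  of {0, 1}, and whatever the upper positions are spared has been paid below. As carries 0 and 1 are
  both free, \<open>x\<close> may lie anywhere between the scaled repunit and its scaled
  successor.\<close>

lemma total_weight_ge:
  fixes q :: nat and A :: "nat \<Rightarrow> int" and w :: "nat \<Rightarrow> nat" and N :: int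
  assumes q: "q \<ge> 3" and A: "\<And>i. i < j + m \<Longrightarrow> \<bar>A i\<bar> \<le> int q * int (w i)"
    and x: "x = N * int q ^ (j + m) + (\<Sum>i<j + m. A i * int q ^ i)"
    and lo: "int q ^ j * int (subtree_size q m) \<le> x"
    and hi: "x \<le> int q ^ j * (int (subtree_size q m) + 1)"
  shows "m \<le> (\<Sum>i<j + m. w i)"
proof -
  define l where "l = (\<Sum>i<j. A i * int q ^ i)"
  define u where "u = (\<Sum>i<j. w i)"
  define y where "y = (\<Sum>i<m. A (j + i) * int q ^ i)"
  define e where "e = y + N * int q ^ m - int (subtree_size q m)"
  have Q: "int q ^ j > 0" using q by simp
  have split: "(\<Sum>i<j + m. f i) = (\<Sum>i<j. f i) + (\<Sum>i<m. f (j + i))" for f :: "nat \<Rightarrow> 'a::comm_monoid_add"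
    by (induction m) (auto simp: add.assoc)
  have "x = l + int q ^ j * (int (subtree_size q m) + e)"
    unfolding x split l_def e_def y_def
    by (simp add: sum_distrib_left power_add algebra_simps)
  moreover have l: "\<bar>l\<bar> \<le> int u * int q ^ j"
    unfolding l_def u_def using q A by (intro low_digits_le) auto
  ultimately have "int q ^ j * e \<le> int q ^ j * (1 + int u)" "int q ^ j * (- int u) \<le> int q ^ j * e"
    using lo hi by (auto simp: algebra_simps abs_le_iff)
  then have "e \<le> 1 + int u" "- int u \<le> e" using Q mult_le_cancel_left_pos by blast+
  then have "max 0 (max (- e) (e - 1)) \<le> int u" by auto
  moreover have "int (\<Sum>i<m. w (j + i)) \<ge> int m - max 0 (max (- e) (e - 1))"
    using q A by (intro digits_weight_ge[where A = "\<lambda>i. A (j + i)" and N = "- N"])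
      (auto simp: e_def y_def)
  ultimately show ?thesis unfolding split u_def by linarith
qed

text \<open>One greedy step. A remainder below t_(i+1) = q t_i + 1 meets the hypothesis with t =
  t_i. The extreme value would need the digit \<open>q\<close>; it is split off because the
  expansion then ends.\<close>

lemma digit_cases:
  fixes R t q :: nat
  assumes "R \<le> q * t"
  obtains "R = q * t" | e R' where "e < q" "R = e * t + R'" "R' < t"
proof (cases "R = q * t")
  case False
  then have "R < q * t" using assms by simp
  then have "0 < t" "R div t < q" by (auto simp: less_mult_imp_div_less intro: gr0I)
  then show ?thesis using that(2)[of "R div t" "R mod t"] by simp
qed (use that in auto)

subsection \<open>Trees by levels\<close>

text \<open>Levels are indexed by height: the leaves form \<open>L 0\<close> and the root
  \<open>L d\<close>. Thus the subtree at a vertex of \<open>L i\<close> has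
  \<open>subtree_size q (Suc i)\<close> vertices.\<close>

locale leveled_tree =
  fixes q d :: nat and G :: "('a, 'b) pre_digraph"
    and L :: "nat \<Rightarrow> 'a set" and ch :: "'a \<Rightarrow> 'a set"
  assumes finite_verts: "finite (verts G)"
    and verts_levels: "verts G = (\<Union>i\<le>d. L i)"
    and levels_disjoint: "i \<noteq> j \<Longrightarrow> L i \<inter> L j = {}"
    and root_level: "card (L d) = 1"
    and card_ch: "v \<in> L (Suc i) \<Longrightarrow> card (ch v) = q"
    and ch_level: "i < d \<Longrightarrow> (\<Union>v\<in>L (Suc i). ch v) = L i"
    and ch_disjoint: "u \<noteq> v \<Longrightarrow> ch u \<inter> ch v = {}"
    and ch_leaf: "v \<in> L 0 \<Longrightarrow> ch v = {}"
    and neighborhood_iff: "v \<in> verts G \<Longrightarrow> u \<in> neighborhood G v \<longleftrightarrow> u \<in> ch v \<or> v \<in> ch u"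
begin

lemma finite_level: "i \<le> d \<Longrightarrow> finite (L i)"
  using finite_verts unfolding verts_levels by auto

lemma ch_subset: "v \<in> L (Suc i) \<Longrightarrow> i < d \<Longrightarrow> ch v \<subseteq> L i"
  using ch_level by blast

lemma finite_ch: "v \<in> L (Suc i) \<Longrightarrow> i < d \<Longrightarrow> finite (ch v)"
  using ch_subset finite_level by (meson finite_subset less_imp_le)

lemma card_children:
  assumes "i < d" and "A \<subseteq> L (Suc i)"
  shows "card (\<Union>v\<in>A. ch v) = q * card A"
proof -
  have A: "finite A" using assms finite_level by (meson Suc_leI finite_subset)
  have "card (\<Union>v\<in>A. ch v) = (\<Sum>v\<in>A. card (ch v))"
    using A assms finite_ch ch_disjoint by (intro card_UN_disjoint) blast+
  also have "\<dots> = (\<Sum>v\<in>A. q)" using assms card_ch by (intro sum.cong) auto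
  also have "\<dots> = q * card A" by simp
  finally show ?thesis .
qed

lemma card_level: "i \<le> d \<Longrightarrow> card (L i) = q ^ (d - i)"
proof (induction rule: inc_induct)
  case base
  then show ?case by (simp add: root_level)
next
  case (step n)
  have "card (L n) = q * card (L (Suc n))"
    using card_children[of n "L (Suc n)"] ch_level[of n] step by simp
  then show ?case using step by (simp add: Suc_diff_Suc flip: power_Suc)
qed

lemma card_UN_levels: "I \<subseteq> {..d} \<Longrightarrow> S \<subseteq> verts G \<Longrightarrow> card (S \<inter> (\<Union>i\<in>I. L i)) = (\<Sum>i\<in>I. card (S \<inter> L i))"
proof -
  assume I: "I \<subseteq> {..d}" and S: "S \<subseteq> verts G"
  have "card (\<Union>i\<in>I. S \<inter> L i) = (\<Sum>i\<in>I. card (S \<inter> L i))"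
  proof (intro card_UN_disjoint ballI impI)
    show "finite I" using I finite_subset by blast
  next
    fix i assume "i \<in> I"
    then show "finite (S \<inter> L i)" using I finite_level by auto
  next
    fix i j :: nat assume "i \<noteq> j"
    then show "S \<inter> L i \<inter> (S \<inter> L j) = {}" using levels_disjoint[of i j] by blast
  qed
  then show ?thesis by simp
qed

lemma card_eq_sum_levels: "S \<subseteq> verts G \<Longrightarrow> card S = (\<Sum>i\<le>d. card (S \<inter> L i))"
  using card_UN_levels[of "{..d}" S] verts_levels by (simp add: Int_absorb2)

lemma card_verts: "card (verts G) = subtree_size q (Suc d)"
proof -
  have "card (verts G) = (\<Sum>i\<le>d. q ^ (d - i))"
    using card_eq_sum_levels[of "verts G"] card_level verts_levels
    by (simp add: Int_absorb1 SUP_upper)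
  also have "\<dots> = (\<Sum>i\<le>d. q ^ i)"
    by (rule sum.reindex_bij_witness[of _ "\<lambda>i. d - i" "\<lambda>i. d - i"]) auto
  finally show ?thesis by (simp add: subtree_size_def lessThan_Suc_atMost)
qed

lemma border_child_cases:
  assumes "S \<subseteq> verts G" and "i < d" and "v \<in> L (Suc i)" and "w \<in> ch v"
  shows "v \<in> S \<Longrightarrow> w \<in> S \<union> vertex_border G S" and "w \<in> S \<Longrightarrow> v \<in> S \<union> vertex_border G S"
proof -
  have vw: "v \<in> verts G" "w \<in> verts G"
    using assms ch_subset[of v i] unfolding verts_levels by fastforce+
  then show "v \<in> S \<Longrightarrow> w \<in> S \<union> vertex_border G S" and "w \<in> S \<Longrightarrow> v \<in> S \<union> vertex_border G S"
    using neighborhood_iff[of v w] neighborhood_iff[of w v] assms(4)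
    unfolding vertex_border_def by auto
qed

section \<open>The size of a set in terms of its border\<close>

definition border_at :: "'a set \<Rightarrow> nat \<Rightarrow> 'a set" where
  "border_at S i = vertex_border G S \<inter> L i"

definition plus_at :: "'a set \<Rightarrow> nat \<Rightarrow> nat" where
  "plus_at S i = (if i = 0 then 0 else card (S \<inter> (\<Union>v\<in>border_at S i. ch v)))"

definition minus_at :: "'a set \<Rightarrow> nat \<Rightarrow> nat" where
  "minus_at S i = (if i < d then card (vertex_border G S \<inter> (\<Union>v\<in>S \<inter> L (Suc i). ch v)) else 0)"

text \<open>Double counting of the children of \<open>S \<inter> L (Suc i)\<close>: each lies in
  \<open>S\<close> or in the border, while a vertex of \<open>S\<close> at height \<open>i\<close>
  has its parent in \<open>S\<close> or in the border.\<close>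

lemma level_step:
  assumes S: "S \<subseteq> verts G" and i: "i < d"
  shows "card (S \<inter> L i) + minus_at S i = q * card (S \<inter> L (Suc i)) + plus_at S (Suc i)"
proof -
  let ?B = "vertex_border G S"
  let ?X = "\<Union>v\<in>S \<inter> L (Suc i). ch v" and ?Y = "\<Union>v\<in>border_at S (Suc i). ch v"
  have SB: "S \<inter> ?B = {}" by (auto simp: vertex_border_def)
  have sub: "?X \<subseteq> L i" "?Y \<subseteq> L i" using ch_level[OF i] by (auto simp: border_at_def)
  have fin: "finite (L i)" using i finite_level by simp
  have "S \<inter> L i = S \<inter> ?X \<union> S \<inter> ?Y"
  proof
    show "S \<inter> L i \<subseteq> S \<inter> ?X \<union> S \<inter> ?Y"
    proof
      fix w assume w: "w \<in> S \<inter> L i"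
      then obtain v where v: "v \<in> L (Suc i)" "w \<in> ch v" using ch_level[OF i] by blast
      then show "w \<in> S \<inter> ?X \<union> S \<inter> ?Y"
        using w border_child_cases(2)[OF S i v] by (auto simp: border_at_def)
    qed
  qed (use sub in blast)
  moreover have "(S \<inter> ?X) \<inter> (S \<inter> ?Y) = {}"
  proof (rule ccontr)
    assume "\<not> ?thesis"
    then obtain u v w where "u \<in> S" "v \<in> ?B" "w \<in> ch u" "w \<in> ch v"
      unfolding border_at_def by blast
    moreover from this have "u \<noteq> v" using SB by blast
    ultimately show False using ch_disjoint[of u v] by blast
  qed
  moreover have "finite (S \<inter> ?X)" "finite (S \<inter> ?Y)"
    using finite_subset[OF _ fin] sub by (meson inf.coboundedI2)+
  ultimately have "card (S \<inter> L i) = card (S \<inter> ?X) + card (S \<inter> ?Y)"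
    by (metis card_Un_disjoint)
  moreover have "card (S \<inter> ?X) + card (?B \<inter> ?X) = card ?X"
  proof -
    have "?X = S \<inter> ?X \<union> ?B \<inter> ?X" using border_child_cases(1)[OF S i] by blast
    moreover have "(S \<inter> ?X) \<inter> (?B \<inter> ?X) = {}" using SB by blast
    moreover have "finite (S \<inter> ?X)" "finite (?B \<inter> ?X)"
      using finite_subset[OF _ fin] sub by (meson inf.coboundedI2)+
    ultimately show ?thesis
      by (metis card_Un_disjoint)
  qed
  moreover have "card ?X = q * card (S \<inter> L (Suc i))"
    using card_children[OF i] by simp
  ultimately show ?thesis
    using i by (simp add: plus_at_def minus_at_def)
qed

lemma minus_at_le: "i \<le> d \<Longrightarrow> minus_at S i \<le> card (border_at S i)"
  unfolding minus_at_def border_at_def using ch_level[of i] finite_level[of i]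
  by (auto intro!: card_mono)

lemma plus_at_le: "i \<le> d \<Longrightarrow> plus_at S i \<le> q * card (border_at S i)"
proof (cases i)
  case (Suc j)
  assume "i \<le> d"
  then have j: "j < d" using Suc by simp
  have "card (S \<inter> (\<Union>v\<in>border_at S i. ch v)) \<le> card (\<Union>v\<in>border_at S i. ch v)"
    using ch_level[OF j] finite_level[of j] j Suc
    by (intro card_mono) (auto simp: border_at_def intro!: finite_subset[of _ "L j"])
  also have "\<dots> = q * card (border_at S i)"
    using card_children[OF j] Suc by (simp add: border_at_def)
  finally show ?thesis by (simp add: plus_at_def Suc)
qed (simp add: plus_at_def)

text \<open>The left side is the size reached when every vertex of \<open>S\<close> at height
  \<open>i\<close> carries a full subtree; descending one level corrects it by
  \<open>level_step\<close>. The indices differ by one because \<open>plus_at\<close> is indexed by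
  the height of the parent of the gained subtrees, \<open>minus_at\<close> by that of the root of
  the lost ones.\<close>

lemma sum_levels_from:
  assumes S: "S \<subseteq> verts G" and "i \<le> d"
  shows "(\<Sum>j\<in>{i<..d}. int (card (S \<inter> L j))) + int (card (S \<inter> L i)) * int (subtree_size q (Suc i))
    = int (card (S \<inter> L d)) * int (subtree_size q (Suc d))
      + (\<Sum>j\<in>{i..<d}. (int (plus_at S (Suc j)) - int (minus_at S j)) * int (subtree_size q (Suc j)))"
  using assms(2)
proof (induction rule: inc_induct)
  case base
  then show ?case by simp
next
  case (step n)
  have c: "int (card (S \<inter> L n))
      = int q * int (card (S \<inter> L (Suc n))) + int (plus_at S (Suc n)) - int (minus_at S n)"
    using arg_cong[OF level_step[OF S step.hyps(2)], of int] by (simp add: algebra_simps)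
  have "{n<..d} = insert (Suc n) {Suc n<..d}" "{n..<d} = insert n {Suc n..<d}"
    using step.hyps by auto
  then show ?case
    using step.IH by (simp add: subtree_size_Suc[of q "Suc n"] c algebra_simps)
qed

text \<open>Multiplying by \<open>q - 1\<close> turns t_i into q^i - 1. The powers form the
  expansion on the right; the ones are collected in the bracket on the left, the error linear in the
  border.\<close>

lemma card_eq_border_contributions:
  assumes S: "S \<subseteq> verts G"
  shows "(int q - 1) * int (card S) + (int (card (S \<inter> L d))
      + (\<Sum>i\<le>d. int (plus_at S i) - int (minus_at S i)))
    = int (card (S \<inter> L d)) * int q ^ Suc d
      + (\<Sum>i<Suc d. (int (plus_at S i) - int q * int (minus_at S i)) * int q ^ i)"
proof -
  let ?f = "int (card (S \<inter> L d))"
  let ?C = "\<lambda>i. int (plus_at S i)" and ?P = "\<lambda>i. int (minus_at S i)"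
  have split: "{..d} = insert 0 {0<..d}" by auto
  have "int (card S) = ?f * int (subtree_size q (Suc d))
      + (\<Sum>j<d. (?C (Suc j) - ?P j) * int (subtree_size q (Suc j)))"
    using sum_levels_from[OF S, of 0]
    by (simp add: card_eq_sum_levels[OF S] split subtree_size_Suc atLeast0LessThan)
  then have "(int q - 1) * int (card S) = ?f * ((int q - 1) * int (subtree_size q (Suc d)))
      + (\<Sum>j<d. (?C (Suc j) - ?P j) * ((int q - 1) * int (subtree_size q (Suc j))))"
    by (simp add: distrib_left sum_distrib_left mult_ac)
  also have "\<dots> = ?f * (int q ^ Suc d - 1) + (\<Sum>j<d. (?C (Suc j) - ?P j) * (int q ^ Suc j - 1))"
    by (simp only: subtree_size_closed)
  also have "(\<Sum>j<d. (?C (Suc j) - ?P j) * (int q ^ Suc j - 1))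
      = (\<Sum>j<d. ?C (Suc j) * int q ^ Suc j) - (\<Sum>j<d. int q * ?P j * int q ^ j)
        - (\<Sum>j<d. ?C (Suc j)) + (\<Sum>j<d. ?P j)"
    by (simp add: algebra_simps sum.distrib sum_subtractf)
  also have "(\<Sum>j<d. ?C (Suc j) * int q ^ Suc j) = (\<Sum>j<Suc d. ?C j * int q ^ j)"
    unfolding sum.lessThan_Suc_shift by (simp add: plus_at_def)
  also have "(\<Sum>j<d. ?C (Suc j)) = (\<Sum>j<Suc d. ?C j)"
    unfolding sum.lessThan_Suc_shift by (simp add: plus_at_def)
  also have "(\<Sum>j<d. int q * ?P j * int q ^ j) = (\<Sum>j<Suc d. int q * ?P j * int q ^ j)"
    by (simp add: minus_at_def)
  also have "(\<Sum>j<d. ?P j) = (\<Sum>j<Suc d. ?P j)"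
    by (simp add: minus_at_def)
  finally show ?thesis
    by (simp add: lessThan_Suc_atMost[symmetric] left_diff_distrib sum_subtractf algebra_simps)
qed

lemma vertex_border_subset: "vertex_border G S \<subseteq> verts G"
  by (auto simp: vertex_border_def)

lemma card_border_eq_sum: "card (vertex_border G S) = (\<Sum>i\<le>d. card (border_at S i))"
  using card_eq_sum_levels[OF vertex_border_subset] by (simp add: border_at_def)

text \<open>With at most \<open>k\<close> border vertices the error lies between \<open>- k\<close>
  and \<open>q * k + 1\<close>. The shift by \<open>k\<close> and the hypothesis \<open>big\<close>
  keep the corrected value between the repunit and its successor, so \<open>Suc d - j > k\<close>
  positions must be paid. The window consists of \<open>q - 1\<close> consecutive integers, hence
  contains a multiple of \<open>q - 1\<close>.\<close>

lemma border_ge: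
  assumes q: "q \<ge> 3" and j: "j \<le> d" and S: "S \<subseteq> verts G" and k: "k + j \<le> d"
    and big: "(q + 1) * (k + 1) \<le> q ^ j"
    and lo: "int q ^ j * int (subtree_size q (Suc d - j)) + int k \<le> (int q - 1) * int (card S)"
    and hi: "(int q - 1) * int (card S) \<le> int q ^ j * int (subtree_size q (Suc d - j)) + int k + int q - 2"
  shows "k < card (vertex_border G S)"
proof (rule ccontr)
  assume "\<not> ?thesis"
  then have le: "card (vertex_border G S) \<le> k" by simp
  let ?A = "\<lambda>i. int (plus_at S i) - int q * int (minus_at S i)"
  let ?w = "\<lambda>i. card (border_at S i)"
  define m where "m = Suc d - j"
  define E where "E = int (card (S \<inter> L d)) + (\<Sum>i\<le>d. int (plus_at S i) - int (minus_at S i))"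
  have m: "j + m = Suc d" using j by (simp add: m_def)
  have "card (S \<inter> L d) \<le> 1"
    using root_level finite_level[of d] by (metis card_mono inf_le2 order_refl)
  moreover have "(\<Sum>i\<le>d. int (plus_at S i) - int (minus_at S i)) \<le> (\<Sum>i\<le>d. int q * int (?w i))"
    using plus_at_le by (intro sum_mono) (smt (verit) atMost_iff of_nat_0_le_iff of_nat_le_iff of_nat_mult)
  moreover have "(\<Sum>i\<le>d. - int (?w i)) \<le> (\<Sum>i\<le>d. int (plus_at S i) - int (minus_at S i))"
    using minus_at_le by (intro sum_mono) (smt (verit) atMost_iff of_nat_0_le_iff of_nat_le_iff)
  moreover have "(\<Sum>i\<le>d. int (?w i)) \<le> int k"
    using le unfolding card_border_eq_sum by (simp flip: of_nat_sum)
  moreover from this have "(\<Sum>i\<le>d. int q * int (?w i)) \<le> int q * int k"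
    unfolding sum_distrib_left[symmetric] by (intro mult_left_mono) auto
  ultimately have E: "- int k \<le> E" "E \<le> int q * int k + 1"
    by (auto simp: E_def sum_negf)
  have A: "\<bar>?A i\<bar> \<le> int q * int (?w i)" if "i < j + m" for i
  proof -
    have "int (plus_at S i) \<le> int q * int (?w i)"
      using plus_at_le[of i S] that m by (metis Suc_eq_plus1 less_Suc_eq_le of_nat_le_iff of_nat_mult)
    moreover have "int q * int (minus_at S i) \<le> int q * int (?w i)"
      using minus_at_le[of i S] that m by (intro mult_left_mono) auto
    moreover have "0 \<le> int q * int (minus_at S i)" by simp
    ultimately show ?thesis by linarith
  qed
  have "int ((q + 1) * (k + 1)) \<le> int (q ^ j)"
    using big by (simp only: of_nat_le_iff)
  then have big': "int q * int k + int k + int q + 1 \<le> int q ^ j"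
    by (simp add: algebra_simps)
  have "m \<le> (\<Sum>i<j + m. ?w i)"
  proof (rule total_weight_ge[OF q A])
    show "(int q - 1) * int (card S) + E
        = int (card (S \<inter> L d)) * int q ^ (j + m) + (\<Sum>i<j + m. ?A i * int q ^ i)"
      unfolding m E_def by (rule card_eq_border_contributions[OF S])
    show "int q ^ j * int (subtree_size q m) \<le> (int q - 1) * int (card S) + E"
      using lo E(1) unfolding m_def[symmetric] by simp
    have "(int q - 1) * int (card S) + E \<le> int q ^ j * int (subtree_size q m) + int q ^ j"
      using hi E(2) big' unfolding m_def[symmetric] by simp
    then show "(int q - 1) * int (card S) + E \<le> int q ^ j * (int (subtree_size q m) + 1)"
      by (simp add: distrib_left)
  qed
  also have "\<dots> \<le> k"
    using le unfolding m lessThan_Suc_atMost card_border_eq_sum .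
  finally show False using k j by (simp add: m_def)
qed

end

subsection \<open>Sets with a small border\<close>

context leveled_tree
begin

text \<open>
  A labelling of the vertices at height at least \<open>i\<close> in which \<open>B\<close> separates \<open>S\<close> from the rest.
\<close>
definition partial_config :: "nat \<Rightarrow> 'a set \<Rightarrow> 'a set \<Rightarrow> bool" where
  "partial_config i S B \<longleftrightarrow> i \<le> d \<and> S \<subseteq> (\<Union>j\<in>{i..d}. L j) \<and> B \<subseteq> (\<Union>j\<in>{i..d}. L j) \<and> S \<inter> B = {} \<and>
     (\<forall>j v w. i \<le> j \<longrightarrow> j < d \<longrightarrow> v \<in> L (Suc j) \<longrightarrow> w \<in> ch v \<longrightarrow>
       (v \<in> S \<longrightarrow> w \<in> S \<union> B) \<and> (w \<in> S \<longrightarrow> v \<in> S \<union> B))"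

text \<open>
  \<open>V\<close> is the size that \<open>S\<close> reaches if the subtrees below it are filled up without further border
  vertices; \<open>s\<close>, \<open>b\<close> and \<open>f\<close> count the vertices at height \<open>i\<close> in \<open>S\<close>, in \<open>B\<close> and in neither.
\<close>
definition state :: "nat \<Rightarrow> int \<Rightarrow> nat \<Rightarrow> nat \<Rightarrow> nat \<Rightarrow> nat \<Rightarrow> bool" where
  "state i V k s b f \<longleftrightarrow> (\<exists>S B. partial_config i S B \<and>
     card (S \<inter> L i) = s \<and> card (B \<inter> L i) = b \<and> card (L i - S - B) = f \<and> card B \<le> k \<and>
     V = int (card (S - L i)) + int s * int (subtree_size q (Suc i)))"

lemma state_mono: "state i V k s b f \<Longrightarrow> k \<le> k' \<Longrightarrow> state i V k' s b f"
  unfolding state_def by (elim exE conjE) (intro exI conjI; (assumption | rule order_trans))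

lemma upper_levels_disjoint: "L i \<inter> (\<Union>j\<in>{Suc i..d}. L j) = {}"
proof -
  have "L i \<inter> L j = {}" if "Suc i \<le> j" for j
    using levels_disjoint[of i j] that by simp
  then show ?thesis by (simp add: Int_UN_distrib)
qed

lemma finite_upper_levels: "finite (\<Union>j\<in>{i..d}. L j)"
  using finite_level by auto

text \<open>
  \<open>C\<close> children of border vertices join \<open>S\<close>; \<open>P\<close> children of vertices in \<open>S\<close> and \<open>Z\<close> other vertices
  join \<open>B\<close>.
\<close>
lemma state_extend:
  assumes st: "state (Suc i) V k s b f"
    and C: "C \<le> q * b" and P: "P \<le> q * s" and Z: "Z \<le> q * f + (q * b - C)"
  shows "state i (V + (int C - int P) * int (subtree_size q (Suc i))) (k + P + Z)
    (q * s - P + C) (P + Z) (q * f + (q * b - C) - Z)"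
proof -
  obtain S B where cfg: "partial_config (Suc i) S B"
    and s: "card (S \<inter> L (Suc i)) = s" and b: "card (B \<inter> L (Suc i)) = b"
    and f: "card (L (Suc i) - S - B) = f" and k: "card B \<le> k"
    and V: "V = int (card (S - L (Suc i))) + int s * int (subtree_size q (Suc (Suc i)))"
    using st unfolding state_def by blast
  have i: "i < d" using cfg by (auto simp: partial_config_def)
  have SB: "S \<inter> B = {}" using cfg by (auto simp: partial_config_def)
  define X where "X = (\<Union>v\<in>S \<inter> L (Suc i). ch v)"
  define Y where "Y = (\<Union>v\<in>B \<inter> L (Suc i). ch v)"
  define W where "W = (\<Union>v\<in>L (Suc i) - S - B. ch v)"
  have cX: "card X = q * s" and cY: "card Y = q * b" and cW: "card W = q * f"
    unfolding X_def Y_def W_def s[symmetric] b[symmetric] f[symmetric] by (rule card_children[OF i]; blast)+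
  have sub: "X \<subseteq> L i" "Y \<subseteq> L i" "W \<subseteq> L i" unfolding X_def Y_def W_def using ch_level[OF i] by auto
  have cover: "L i = X \<union> Y \<union> W" unfolding X_def Y_def W_def ch_level[OF i, symmetric] by blast
  have fin: "finite (L i)" using i finite_level by simp
  have finX: "finite X" and finY: "finite Y" and finW: "finite W"
    using finite_subset[OF _ fin] sub by blast+
  have disj: "(\<Union>v\<in>A1. ch v) \<inter> (\<Union>v\<in>A2. ch v) = {}" if "A1 \<inter> A2 = {}" for A1 A2
  proof (rule ccontr)
    assume "\<not> ?thesis"
    then obtain u v w where "u \<in> A1" "v \<in> A2" "w \<in> ch u" "w \<in> ch v" by blast
    moreover from this that have "u \<noteq> v" by blast
    ultimately show False using ch_disjoint[of u v] by blast
  qed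
  have XY: "X \<inter> Y = {}" unfolding X_def Y_def using SB by (intro disj) blast
  have XW: "X \<inter> W = {}" unfolding X_def W_def by (intro disj) blast
  have YW: "Y \<inter> W = {}" unfolding Y_def W_def by (intro disj) blast
  obtain Ps where Ps: "Ps \<subseteq> X" "card Ps = P" using P cX by (metis obtain_subset_with_card_n)
  obtain Cs where Cs: "Cs \<subseteq> Y" "card Cs = C" using C cY by (metis obtain_subset_with_card_n)
  have finP: "finite Ps" and finC: "finite Cs"
    using finite_subset[OF Ps(1) finX] finite_subset[OF Cs(1) finY] .
  have cYC: "card (Y - Cs) = q * b - C"
    using card_Diff_subset[OF finC Cs(1)] Cs(2) cY by simp
  have cR: "card ((Y - Cs) \<union> W) = q * f + (q * b - C)"
  proof -
    have "(Y - Cs) \<inter> W = {}" using YW by blast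
    then show ?thesis using card_Un_disjoint[of "Y - Cs" W] finY finW cYC cW by simp
  qed
  then obtain Zs where Zs: "Zs \<subseteq> (Y - Cs) \<union> W" "card Zs = Z"
    using Z by (metis obtain_subset_with_card_n)
  have finR: "finite ((Y - Cs) \<union> W)" using finY finW by simp
  have finZ: "finite Zs" using finite_subset[OF Zs(1) finR] .
  define N where "N = (X - Ps) \<union> Cs"
  define M where "M = Ps \<union> Zs"
  define S' where "S' = S \<union> N"
  define B' where "B' = B \<union> M"
  have new: "N \<subseteq> L i" "M \<subseteq> L i"
    unfolding N_def M_def using sub Ps(1) Cs(1) Zs(1) by blast+
  have NM: "N \<inter> M = {}"
    unfolding N_def M_def using Ps(1) Cs(1) Zs(1) XY XW YW by blast
  have up: "S \<subseteq> (\<Union>j\<in>{Suc i..d}. L j)" "B \<subseteq> (\<Union>j\<in>{Suc i..d}. L j)"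
    using cfg by (auto simp: partial_config_def)
  have SL: "S \<inter> L i = {}" "B \<inter> L i = {}" using up upper_levels_disjoint[of i] by blast+
  have S'L: "S' \<inter> L i = N" "S' - L i = S"
    using SL new unfolding S'_def by blast+
  have B'L: "B' \<inter> L i = M" using SL new unfolding B'_def by blast
  have PZ: "Ps \<inter> Zs = {}" using Ps(1) Zs(1) XY XW by blast
  have cPZ: "card M = P + Z"
    unfolding M_def using card_Un_disjoint[OF finP finZ PZ] Ps(2) Zs(2) by simp
  have "L i - S' - B' = L i - N - M"
    unfolding S'_def B'_def using SL by blast
  also have "\<dots> = (Y - Cs \<union> W) - Zs"
    unfolding N_def M_def cover using Ps(1) Cs(1) Zs(1) XY XW YW by blast
  finally have c1: "card (L i - S' - B') = q * f + (q * b - C) - Z"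
    using card_Diff_subset[OF finZ Zs(1)] Zs(2) cR by simp
  have "card (X - Ps) = q * s - P"
    using card_Diff_subset[OF finP Ps(1)] Ps(2) cX by simp
  moreover have "(X - Ps) \<inter> Cs = {}" using Cs(1) XY by blast
  ultimately have c2: "card (S' \<inter> L i) = q * s - P + C"
    using card_Un_disjoint[of "X - Ps" Cs] finX finC Cs(2) unfolding S'L N_def by simp
  have "finite B" using up(2) finite_upper_levels finite_subset by blast
  then have "card B' = card B + (P + Z)"
    using card_Un_disjoint[of B M] finite_subset[OF new(2) fin] SL(2) new(2) cPZ
    unfolding B'_def by (metis Int_assoc inf.absorb_iff2 inf_bot_left)
  then have c3: "card B' \<le> k + P + Z" using k by simp
  have finS: "finite S" using up(1) finite_upper_levels finite_subset by blast
  have "card (S - L (Suc i)) + s = card S"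
    unfolding s[symmetric] using card_Diff_subset_Int[of S "L (Suc i)"] finS
    by (simp add: card_mono)
  then have V': "V + (int C - int P) * int (subtree_size q (Suc i))
      = int (card (S' - L i)) + int (q * s - P + C) * int (subtree_size q (Suc i))"
    unfolding V S'L subtree_size_Suc[of q "Suc i"] using P
    by (simp add: of_nat_diff algebra_simps)
  have levels: "(\<Union>j\<in>{i..d}. L j) = L i \<union> (\<Union>j\<in>{Suc i..d}. L j)"
    using i by (auto simp: atLeastAtMost_insertL[of i d, symmetric] simp del: atLeastAtMost_insertL)
  have "partial_config i S' B'"
    unfolding partial_config_def
  proof (intro conjI allI impI)
    show "i \<le> d" using i by simp
    show "S' \<subseteq> (\<Union>j\<in>{i..d}. L j)" "B' \<subseteq> (\<Union>j\<in>{i..d}. L j)"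
      unfolding levels S'_def B'_def using up new by blast+
    show "S' \<inter> B' = {}"
      unfolding S'_def B'_def using SB SL new NM by blast
  next
    fix j v w assume j: "i \<le> j" "j < d" "v \<in> L (Suc j)" "w \<in> ch v"
    consider "j = i" | "Suc i \<le> j" using j(1) by linarith
    then have "(v \<in> S' \<longrightarrow> w \<in> S' \<union> B') \<and> (w \<in> S' \<longrightarrow> v \<in> S' \<union> B')"
    proof cases
      case 1
      have w: "w \<in> L i" using ch_subset[OF j(3,2)] j(4) 1 by blast
      have v: "v \<notin> L i" using levels_disjoint[of i "Suc i"] j(3) 1 by auto
      have "w \<in> S' \<union> B'" if "v \<in> S'"
      proof -
        have "v \<in> S" using that v new(1) unfolding S'_def by blast
        then have "w \<in> X" unfolding X_def using j 1 by blast
        then show ?thesis unfolding S'_def B'_def N_def M_def by blast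
      qed
      moreover have "v \<in> S' \<union> B'" if "w \<in> S'"
      proof -
        have "w \<in> N" using that w S'L(1) by blast
        then have "w \<in> X \<union> Y" using Cs(1) unfolding N_def by blast
        then obtain u where u: "u \<in> S \<union> B" "w \<in> ch u" unfolding X_def Y_def by blast
        then have "u = v" using ch_disjoint[of u v] j(4) by blast
        then show ?thesis using u(1) unfolding S'_def B'_def by blast
      qed
      ultimately show ?thesis by blast
    next
      case 2
      have "w \<in> L j" using ch_subset[OF j(3,2)] j(4) by blast
      then have "w \<notin> L i" using levels_disjoint[of i j] 2 by auto
      moreover have "v \<notin> L i" using levels_disjoint[of i "Suc j"] j by auto
      moreover have "(v \<in> S \<longrightarrow> w \<in> S \<union> B) \<and> (w \<in> S \<longrightarrow> v \<in> S \<union> B)"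
        using cfg 2 j unfolding partial_config_def by blast
      ultimately show ?thesis using new unfolding S'_def B'_def by blast
    qed
    then show "v \<in> S' \<Longrightarrow> w \<in> S' \<union> B'" "w \<in> S' \<Longrightarrow> v \<in> S' \<union> B'" by blast+
  qed
  then show ?thesis
    unfolding state_def using c1 c2 c3 V' B'L cPZ by blast
qed

lemma state_root: "state d 0 0 0 0 1" "state d 0 1 0 1 0"
proof -
  obtain r where r: "L d = {r}" using root_level by (metis card_1_singletonE)
  have "partial_config d {} {}" by (auto simp: partial_config_def)
  then show "state d 0 0 0 0 1" using r unfolding state_def by fastforce
  have "partial_config d {} {r}" using r by (auto simp: partial_config_def)
  then show "state d 0 1 0 1 0" using r unfolding state_def by fastforce
qed

text \<open>All higher levels stay outside both \<open>S\<close> and \<open>B\<close>, so an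
  expansion can begin at height \<open>h\<close> at no cost for the levels above.\<close>

lemma state_start:
  assumes "h \<le> d" and "q \<ge> 2"
  shows "\<exists>f. state h 0 1 0 1 f"
proof (cases "h = d")
  case True
  then show ?thesis using state_root by blast
next
  case False
  have free: "\<exists>f\<ge>1. state i 0 0 0 0 f" if "i \<le> d" for i
    using that
  proof (induction rule: inc_induct)
    case base
    then show ?case using state_root(1) by blast
  next
    case (step n)
    then obtain f where "f \<ge> 1" "state (Suc n) 0 0 0 0 f" by blast
    then show ?case using state_extend[of n 0 0 0 0 f 0 0 0] assms(2)
      by (intro exI[of _ "q * f"]) simp
  qed
  obtain f where "f \<ge> 1" "state (Suc h) 0 0 0 0 f" using free[of "Suc h"] False assms(1) by auto
  then show ?thesis using state_extend[of h 0 0 0 0 f 0 0 1] assms(2) by auto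
qed

section \<open>Expansions with one border vertex per height\<close>

definition realizable :: "int \<Rightarrow> nat \<Rightarrow> bool" where
  "realizable V k \<longleftrightarrow> (\<exists>S \<subseteq> verts G. int (card S) = V \<and> card (vertex_border G S) \<le> k)"

lemma realizable_mono: "realizable V k \<Longrightarrow> k \<le> k' \<Longrightarrow> realizable V k'"
  unfolding realizable_def using order_trans by blast

lemma state_realizable: "state i V k s b f \<Longrightarrow> realizable V k"
proof (induction i arbitrary: V s b f)
  case 0
  then obtain S B where cfg: "partial_config 0 S B" and k: "card B \<le> k"
    and V: "V = int (card (S - L 0)) + int (card (S \<inter> L 0)) * int (subtree_size q (Suc 0))"
    unfolding state_def by blast
  have S: "S \<subseteq> verts G" and B: "B \<subseteq> verts G"
    using cfg unfolding partial_config_def verts_levels by (auto simp: atMost_atLeast0)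
  have "finite S" using S finite_verts finite_subset by blast
  then have "card (S - L 0) + card (S \<inter> L 0) = card S"
    using card_Diff_subset_Int[of S "L 0"] by (simp add: card_mono)
  then have V': "V = int (card S)" unfolding V by (simp add: subtree_size_Suc)
  have edge: "(v \<in> S \<longrightarrow> w \<in> S \<union> B) \<and> (w \<in> S \<longrightarrow> v \<in> S \<union> B)"
    if v: "v \<in> verts G" and w: "w \<in> ch v" for v w
  proof -
    obtain i where i: "i \<le> d" "v \<in> L i" using v verts_levels by auto
    then obtain j where "i = Suc j" using ch_leaf w by (cases i) auto
    then show ?thesis using i w cfg unfolding partial_config_def by (meson Suc_le_eq zero_le)
  qed
  have "vertex_border G S \<subseteq> B"
  proof
    fix v assume "v \<in> vertex_border G S"
    then obtain u where "v \<in> verts G" "v \<notin> S" "u \<in> S" "u \<in> ch v \<or> v \<in> ch u"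
      using neighborhood_iff unfolding vertex_border_def by auto
    then show "v \<in> B" using edge[of v u] edge[of u v] S by blast
  qed
  then have "card (vertex_border G S) \<le> k"
    using k card_mono[of B] finite_subset[OF B finite_verts] by (meson order_trans)
  then show ?case using S V' unfolding realizable_def by blast
next
  case (Suc i)
  \<comment> \<open>Extending with no new border vertex fills the subtrees below \<open>S\<close>,
    which leaves \<open>V\<close> unchanged.\<close>
  show ?case using state_extend[OF Suc.prems, of 0 0 0] Suc.IH by simp
qed

text \<open>
  If \<open>x = 1\<close>, one of the border vertices at height \<open>i\<close> is committed to having all its children in
  \<open>S\<close>, and their subtrees are already counted in \<open>V\<close>.
\<close>
definition ready :: "nat \<Rightarrow> int \<Rightarrow> nat \<Rightarrow> bool" where
  "ready i V k \<longleftrightarrow> (\<exists>V0 s b f x. state i V0 k s b f \<and> 1 \<le> s \<and> x \<le> 1 \<and> 1 + x \<le> b \<and>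
     V = V0 + int (x * q * subtree_size q i))"

lemma ready_mono: "ready i V k \<Longrightarrow> k \<le> k' \<Longrightarrow> ready i V k'"
  unfolding ready_def using state_mono by blast

lemma ready_finish:
  assumes "ready (Suc i) V k" and C: "C \<le> q"
  shows "realizable (V + int (C * subtree_size q (Suc i))) k"
proof -
  obtain V0 s b f x where st: "state (Suc i) V0 k s b f" and b: "1 + x \<le> b"
    and V: "V = V0 + int (x * q * subtree_size q (Suc i))"
    using assms(1) unfolding ready_def by blast
  have "q * (1 + x) \<le> q * b" using b by (rule mult_left_mono) simp
  then have "C + x * q \<le> q * b" using C by (simp add: algebra_simps)
  from state_realizable[OF state_extend[OF st this, of 0 0]]
  show ?thesis unfolding V by (simp add: algebra_simps)
qed

text \<open>The new border vertex is not a child of a vertex in \<open>S\<close>. Room for it exists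
  even if \<open>f = 0\<close>: as \<open>e < q\<close>, some child of a border vertex stays outside
  \<open>S\<close>.\<close>

lemma ready_step:
  assumes "ready (Suc i) V k" and e: "e < q"
  shows "ready i (V + int (e * subtree_size q (Suc i))) (k + 1)"
proof -
  obtain V0 s b f x where st: "state (Suc i) V0 k s b f" and s: "1 \<le> s" and b: "1 + x \<le> b"
    and V: "V = V0 + int (x * q * subtree_size q (Suc i))"
    using assms(1) unfolding ready_def by blast
  have "q * (1 + x) \<le> q * b" using b by (rule mult_left_mono) simp
  then have C: "e + x * q < q * b" using e by (simp add: algebra_simps)
  then have Z: "1 \<le> q * f + (q * b - (e + x * q))" by linarith
  have "q * 1 \<le> q * s" using s by (rule mult_left_mono) simp
  then have "1 \<le> q * s - 0 + (e + x * q)" using e by linarith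
  moreover have "V + int (e * subtree_size q (Suc i))
      = V0 + (int (e + x * q) - int 0) * int (subtree_size q (Suc i)) + int (0 * q * subtree_size q i)"
    unfolding V by (simp add: algebra_simps)
  ultimately show ?thesis
    using state_extend[OF st less_imp_le[OF C] le0 Z] unfolding ready_def
    by (metis add.right_neutral add_0 le_refl zero_le_one)
qed

text \<open>
  If the border vertex \<open>v\<close> at height \<open>i + 1\<close> has a single child \<open>w\<close> in \<open>S\<close> and its parent is not in
  \<open>S\<close>, then \<open>w\<close> can replace \<open>v\<close> in the border: the size drops by one at no cost. Making the next
  border vertex a child of a vertex in \<open>S\<close> when \<open>e2 = 0\<close> brings about exactly this situation.
\<close>
lemma ready_decrement:
  assumes "ready (Suc (Suc i)) V k" and q: "3 \<le> q" and e1: "e1 < q" and e2: "e2 \<le> 1"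
  shows "ready i (V + int (e1 * subtree_size q (Suc (Suc i))) + int (e2 * subtree_size q (Suc i)) - 1) (k + 2)"
proof -
  obtain V0 s b f x where st: "state (Suc (Suc i)) V0 k s b f" and s: "1 \<le> s" and b: "1 + x \<le> b"
    and V: "V = V0 + int (x * q * subtree_size q (Suc (Suc i)))"
    using assms(1) unfolding ready_def by blast
  have "q * (1 + x) \<le> q * b" using b by (rule mult_left_mono) simp
  then have C: "e1 + x * q < q * b" using e1 by (simp add: algebra_simps)
  define f' where "f' = q * f + (q * b - (e1 + x * q)) - 0"
  define s' where "s' = q * s - 0 + (e1 + x * q)"
  have "q * 1 \<le> q * s" using s by (rule mult_left_mono) simp
  then have s': "1 \<le> s'" using q unfolding s'_def by linarith
  have f': "1 \<le> f'" using C by (simp add: f'_def)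
  have st1: "state (Suc i) (V0 + (int (e1 + x * q) - int 0) * int (subtree_size q (Suc (Suc i))))
      (k + 0 + 0) s' (0 + 0) f'"
    unfolding s'_def f'_def using C by (intro state_extend[OF st]) auto
  have "q * 1 \<le> q * s'" using s' by (rule mult_left_mono) simp
  then have s'': "3 \<le> q * s'" using q by linarith
  have "q * 1 \<le> q * f'" using f' by (rule mult_left_mono) simp
  then have f'': "3 \<le> q * f'" using q by linarith
  \<comment> \<open>Height \<open>Suc i\<close> received no border vertex, so height
    \<open>i\<close> may receive two: \<open>1 - e2\<close> of them below \<open>S\<close>, the
    others elsewhere. One is committed and adds q t_i = t_(i+1) - 1, which is the digit's missing
    subtree less one vertex.\<close>
  define W where "W = V0 + (int (e1 + x * q) - int 0) * int (subtree_size q (Suc (Suc i)))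
    + (int 0 - int (1 - e2)) * int (subtree_size q (Suc i))"
  have "state i W (k + 0 + 0 + (1 - e2) + (1 + e2)) (q * s' - (1 - e2) + 0) ((1 - e2) + (1 + e2))
      (q * f' + (q * (0 + 0) - 0) - (1 + e2))"
    unfolding W_def using s'' f'' e2 by (intro state_extend[OF st1]) auto
  moreover have "1 - e2 + (1 + e2) = 2" "k + 0 + 0 + (1 - e2) + (1 + e2) = k + 2" using e2 by auto
  ultimately have st2: "state i W (k + 2) (q * s' - (1 - e2) + 0) 2
      (q * f' + (q * (0 + 0) - 0) - (1 + e2))"
    by (simp only:)
  show ?thesis
    unfolding ready_def
  proof (intro exI conjI)
    show "state i W (k + 2) (q * s' - (1 - e2) + 0) 2 (q * f' + (q * (0 + 0) - 0) - (1 + e2))"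
      by (rule st2)
    show "1 \<le> q * s' - (1 - e2) + 0" using s'' by linarith
    show "V + int (e1 * subtree_size q (Suc (Suc i))) + int (e2 * subtree_size q (Suc i)) - 1
      = W + int (1 * q * subtree_size q i)"
      unfolding V W_def using e2 by (simp add: of_nat_diff subtree_size_Suc[of q i] algebra_simps)
  qed auto
qed

text \<open>
  Dually, a border vertex with its parent and all but one of its children in \<open>S\<close> can join \<open>S\<close>.
\<close>
lemma ready_increment:
  assumes "ready (Suc (Suc i)) V k" and q: "3 \<le> q" and e1: "e1 < q"
    and e2: "e2 < q" "q \<le> e2 + 2"
  shows "ready i (V + int (e1 * subtree_size q (Suc (Suc i))) + int (e2 * subtree_size q (Suc i)) + 1) (k + 2)"
proof -
  obtain V0 s b f x where st: "state (Suc (Suc i)) V0 k s b f" and s: "1 \<le> s" and b: "1 + x \<le> b"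
    and V: "V = V0 + int (x * q * subtree_size q (Suc (Suc i)))"
    using assms(1) unfolding ready_def by blast
  have "q * (1 + x) \<le> q * b" using b by (rule mult_left_mono) simp
  then have C: "e1 + 1 + x * q \<le> q * b" using e1 by (simp add: algebra_simps)
  define f' where "f' = q * f + (q * b - (e1 + 1 + x * q)) - 0"
  define s' where "s' = q * s - 0 + (e1 + 1 + x * q)"
  \<comment> \<open>One child more than \<open>e1\<close> joins \<open>S\<close>, and
    \<open>p\<close> border vertices below \<open>S\<close> cut off the excess: t_(i+2) - p t_(i+1)
    = e2 t_(i+1) + 1. Since \<open>p \<le> 2\<close>, the budget of two heights suffices.\<close>
  define p where "p = q - e2"
  have p: "p = 1 \<or> p = 2" "q = e2 + p" using e2 by (auto simp: p_def)
  have s': "1 \<le> s'" by (simp add: s'_def)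
  have st1: "state (Suc i) (V0 + (int (e1 + 1 + x * q) - int 0) * int (subtree_size q (Suc (Suc i))))
      (k + 0 + 0) s' (0 + 0) f'"
    unfolding s'_def f'_def using C by (intro state_extend[OF st]) auto
  have "q * 1 \<le> q * s'" using s' by (rule mult_left_mono) simp
  then have s'': "3 \<le> q * s'" using q by linarith
  have "state i (V0 + (int (e1 + 1 + x * q) - int 0) * int (subtree_size q (Suc (Suc i)))
        + (int 0 - int p) * int (subtree_size q (Suc i)))
      (k + 0 + 0 + p + 0) (q * s' - p + 0) (p + 0)
      (q * f' + (q * (0 + 0) - 0) - 0)"
    using s'' p by (intro state_extend[OF st1]) auto
  moreover have "1 \<le> q * s' - p + 0" "1 + 0 \<le> p + 0" using s'' p(1) by linarith+
  moreover have "V + int (e1 * subtree_size q (Suc (Suc i))) + int (e2 * subtree_size q (Suc i)) + 1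
     = V0 + (int (e1 + 1 + x * q) - int 0) * int (subtree_size q (Suc (Suc i)))
        + (int 0 - int p) * int (subtree_size q (Suc i)) + int (0 * q * subtree_size q i)"
  proof -
    have "int q = int e2 + int p" using p(2) by simp
    moreover have "int (subtree_size q (Suc (Suc i))) = int q * int (subtree_size q (Suc i)) + 1"
      by (simp add: subtree_size_Suc[of q "Suc i"])
    ultimately have "int (subtree_size q (Suc (Suc i))) = (int e2 + int p) * int (subtree_size q (Suc i)) + 1"
      by simp
    then show ?thesis unfolding V by (simp add: algebra_simps)
  qed
  ultimately have "ready i (V + int (e1 * subtree_size q (Suc (Suc i))) + int (e2 * subtree_size q (Suc i)) + 1)
      (k + 0 + 0 + p + 0)"
    unfolding ready_def by (metis zero_le_one)
  then show ?thesis by (rule ready_mono) (use p(1) in auto)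
qed

text \<open>Each block of two heights widens the interval of free corrections from
  \<open>- a\<close> to \<open>b\<close> by one, so the bound on \<open>a + b + B\<close> persists.
  At height \<open>l\<close> the interval has at least t_l members: a last remainder up to
  \<open>b\<close> is added, a larger one is rounded up and the difference, at most
  \<open>a\<close>, subtracted.\<close>

lemma realizable_by_blocks:
  assumes q: "q \<in> {3, 4}" and l: "1 \<le> l"
    and "\<And>j. - int a \<le> j \<Longrightarrow> j \<le> int b \<Longrightarrow> ready (l + 2 * B) (V + j) k"
    and "R \<le> q * subtree_size q (l + 2 * B)" and "subtree_size q l \<le> a + b + B + 1"
  shows "realizable (V + int R) (k + 2 * B)"
  using assms(3-)
proof (induction B arbitrary: a b V k R)
  case 0
  obtain l' where l': "l = Suc l'" using l by (cases l) auto
  have rd: "ready (Suc l') (V + j) k" if "- int a \<le> j" "j \<le> int b" for j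
    using "0.prems"(1)[OF that] l' by simp
  from "0.prems"(2) have "R \<le> q * subtree_size q l" by simp
  then show ?case
  proof (cases rule: digit_cases)
    case 1
    then show ?thesis using ready_finish[OF rd[of 0], of q] l' by simp
  next
    case (2 e R')
    show ?thesis
    proof (cases "R' \<le> b")
      case True
      then show ?thesis using ready_finish[OF rd[of "int R'"], of e] 2 l' by (simp add: algebra_simps)
    next
      case False
      then have "- int a \<le> int R' - int (subtree_size q l)" "int R' - int (subtree_size q l) \<le> int b"
        using "0.prems"(3) 2 by linarith+
      from ready_finish[OF rd[OF this], of "e + 1"]
      show ?thesis using 2 l' by (simp add: algebra_simps)
    qed
  qed
next
  case (Suc B)
  define i where "i = l + 2 * B"
  have i: "l + 2 * Suc B = Suc (Suc i)" by (simp add: i_def)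
  have rd: "ready (Suc (Suc i)) (V + j) k" if "- int a \<le> j" "j \<le> int b" for j
    using Suc.prems(1)[OF that] i by simp
  from Suc.prems(2) have "R \<le> q * subtree_size q (Suc (Suc i))" using i by simp
  then show ?case
  proof (cases rule: digit_cases)
    case 1
    then have "realizable (V + int R) k" using ready_finish[OF rd[of 0], of q] by simp
    then show ?thesis by (rule realizable_mono) simp
  next
    case (2 e1 R1)
    from 2(3) have "R1 \<le> q * subtree_size q (Suc i)" by (simp add: subtree_size_Suc[of q "Suc i"])
    then show ?thesis
    proof (cases rule: digit_cases)
      case 1
      then have "realizable (V + int R) (k + 1)"
        using ready_finish[OF ready_step[OF rd[of 0] 2(1)], of q] 2(2) by (simp add: algebra_simps)
      then show ?thesis by (rule realizable_mono) simp
    next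
      case e2: (2 e2 R2)
      let ?V = "V + int (e1 * subtree_size q (Suc (Suc i))) + int (e2 * subtree_size q (Suc i))"
      have R2: "R2 \<le> q * subtree_size q (l + 2 * B)"
        using e2(3) unfolding i_def subtree_size_Suc by simp
      have base: "ready (l + 2 * B) (?V + j) (k + 2)" if "- int a \<le> j" "j \<le> int b" for j
        using ready_step[OF ready_step[OF rd[OF that] 2(1)] e2(1)] by (simp add: i_def algebra_simps)
      \<comment> \<open>The digits 0 and 1 permit a decrement. Any other digit satisfies
        \<open>q \<le> e2 + 2\<close> and permits an increment; this is where
        \<open>q \<le> 4\<close> is used.\<close>
      have "realizable (?V + int R2) (k + 2 + 2 * B)"
      proof (cases "e2 \<le> 1")
        case True
        have "ready (l + 2 * B) (?V + j) (k + 2)" if "- int (Suc a) \<le> j" "j \<le> int b" for j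
        proof (cases "- int a \<le> j")
          case False
          then have "- int a \<le> j + 1" "j + 1 \<le> int b" using that by linarith+
          from ready_decrement[OF rd[OF this] _ 2(1) True] q
          show ?thesis by (auto simp: i_def algebra_simps)
        qed (use base that in blast)
        then show ?thesis using Suc.IH[of "Suc a" b ?V "k + 2" R2] R2 Suc.prems(3) by simp
      next
        case False
        have "ready (l + 2 * B) (?V + j) (k + 2)" if "- int a \<le> j" "j \<le> int (Suc b)" for j
        proof (cases "j \<le> int b")
          case False
          then have "- int a \<le> j - 1" "j - 1 \<le> int b" using that by linarith+
          from ready_increment[OF rd[OF this] _ 2(1) e2(1)] q \<open>\<not> e2 \<le> 1\<close>
          show ?thesis by (auto simp: i_def algebra_simps)
        qed (use base that in blast)
        then show ?thesis using Suc.IH[of a "Suc b" ?V "k + 2" R2] R2 Suc.prems(3) by simp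
      qed
      then show ?thesis using 2(2) e2(2) by (simp add: algebra_simps)
    qed
  qed
qed

text \<open>The budget is one border vertex for each height from \<open>h\<close> down to
  \<open>l\<close>. The hypothesis \<open>room\<close> provides enough two-height blocks for the
  corrections to cover a remainder below t_l; for \<open>l = 1\<close> that remainder is 0.\<close>

lemma realizable_from_height:
  assumes q: "q \<in> {3, 4}" and h: "h \<le> d" and l: "1 \<le> l" "l \<le> h"
    and room: "l = 1 \<or> l + 2 * subtree_size q l \<le> h"
    and s: "subtree_size q h \<le> s" "s \<le> q * subtree_size q h"
  shows "realizable (int s) (h - l + 1)"
proof -
  have q2: "q \<ge> 2" using q by auto
  obtain n where n: "h = Suc n" using l by (cases h) auto
  obtain f where f: "state (Suc n) 0 1 0 1 f" using state_start[OF h q2] n by blast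
  have finish: "realizable (int (C * subtree_size q h)) (h - l + 1)" if "C \<le> q" for C
  proof -
    have "realizable (int (C * subtree_size q h)) 1"
      using state_realizable[OF state_extend[OF f, of C 0 0]] that n by simp
    then show ?thesis by (rule realizable_mono) simp
  qed
  from s(2) show ?thesis
  proof (cases rule: digit_cases)
    case 1
    then show ?thesis using finish[of q] by simp
  next
    case (2 e R)
    \<comment> \<open>A nonzero leading digit supplies the vertex of \<open>S\<close> that
      \<open>ready\<close> demands.\<close>
    have e: "1 \<le> e" using s(1) 2 by (cases e) auto
    have R: "R \<le> q * subtree_size q n" using 2(3) n by (simp add: subtree_size_Suc)
    have "state n (0 + (int e - int 0) * int (subtree_size q (Suc n))) (1 + 0 + 1)
        (q * 0 - 0 + e) (0 + 1) (q * f + (q * 1 - e) - 1)"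
      using 2(1) by (intro state_extend[OF f]) auto
    then have rd: "ready n (int (e * subtree_size q h)) 2"
      unfolding ready_def using e n
      by (intro exI[of _ "int (e * subtree_size q h)"] exI[of _ e] exI[of _ 1]
          exI[of _ "q * f + (q * 1 - e) - 1"] exI[of _ "0::nat"]) (simp add: numeral_2_eq_2)
    show ?thesis
    proof (cases "l = h")
      case True
      have "subtree_size q l > 0" using l by (simp add: subtree_size_pos)
      then have "h = 1" using room True by auto
      then have "R = 0" using R n by simp
      then show ?thesis using finish[of e] 2 by simp
    next
      case False
      then have ln: "l \<le> n" using l n by simp
      have tl: "subtree_size q l \<le> B + 1" if "h \<le> l + 2 * B + 2" for B
      proof (cases "l = 1")
        case True
        then show ?thesis by (simp add: subtree_size_def)
      qed (use room that in linarith)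
      \<comment> \<open>If the number of remaining heights is odd, one plain step precedes the
        blocks.\<close>
      show ?thesis
      proof (cases "even (n - l)")
        case True
        then obtain B where "n - l = 2 * B" by blast
        then have B: "n = l + 2 * B" using ln by simp
        have "realizable (int (e * subtree_size q h) + int R) (2 + 2 * B)"
        proof (rule realizable_by_blocks[OF q l(1), where a = 0 and b = 0])
          show "ready (l + 2 * B) (int (e * subtree_size q h) + j) 2"
            if "- int 0 \<le> j" "j \<le> int 0" for j
            using rd that B by simp
        qed (use R B tl[of B] n in auto)
        then show ?thesis using 2(2) B n by simp
      next
        case False
        then obtain B where "n - l = 2 * B + 1" by (metis oddE)
        then have B: "n = Suc (l + 2 * B)" using ln by simp
        from R show ?thesis
        proof (cases rule: digit_cases)
          case 1
          then have "realizable (int (e * subtree_size q h) + int R) 2"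
            using ready_finish[of "l + 2 * B" _ 2 q] rd B by simp
          then have "realizable (int s) 2" using 2(2) by simp
          then show ?thesis by (rule realizable_mono) (use B n in simp)
        next
          case e': (2 e' R')
          have "realizable (int (e * subtree_size q h) + int (e' * subtree_size q n) + int R') (3 + 2 * B)"
          proof (rule realizable_by_blocks[OF q l(1), where a = 0 and b = 0])
            show "ready (l + 2 * B) (int (e * subtree_size q h) + int (e' * subtree_size q n) + j) 3"
              if "- int 0 \<le> j" "j \<le> int 0" for j
              using ready_step[of "l + 2 * B" _ 2 e'] rd e'(1) that B by simp
            show "R' \<le> q * subtree_size q (l + 2 * B)"
              using e'(3) B by (simp add: subtree_size_Suc)
          qed (use B tl[of B] n in auto)
          then show ?thesis using 2(2) e'(2) B n by (simp add: add.assoc numeral_3_eq_3)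
        qed
      qed
    qed
  qed
qed

text \<open>The last conjunct says that \<open>k\<close> is at most d + 3 - log_q d, stated without
  logarithms.\<close>

lemma realizable_all:
  assumes q: "q \<in> {3, 4}" and s: "s \<le> card (verts G)"
  shows "\<exists>k \<le> d + 3. realizable (int s) k \<and> d \<le> q ^ (d + 3 - k)"
proof -
  have q3: "3 \<le> q" using q by auto
  have less_pow: "n < q ^ n" for n using q3 by (intro power_gt_expt) auto
  consider "s = 0" | "s = subtree_size q (Suc d)" | "0 < s" "s < subtree_size q (Suc d)"
    using s card_verts by linarith
  then show ?thesis
  proof cases
    case 1
    then have "realizable (int s) 0"
      unfolding realizable_def by (intro exI[of _ "{}"]) (auto simp: vertex_border_def)
    then show ?thesis using less_pow[of "d + 3"] by (intro exI[of _ 0]) auto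
  next
    case 2
    then have "realizable (int s) 0"
      unfolding realizable_def using card_verts
      by (intro exI[of _ "verts G"]) (auto simp: vertex_border_def)
    then show ?thesis using less_pow[of "d + 3"] by (intro exI[of _ 0]) auto
  next
    case 3
    define h where "h = (GREATEST h. subtree_size q h \<le> s)"
    have bound: "h' \<le> d" if "subtree_size q h' \<le> s" for h'
      using that 3(2) subtree_size_mono[of "Suc d" h' q] by (meson leD le_trans not_less_eq_eq)
    have hs: "subtree_size q h \<le> s"
      unfolding h_def using bound
      by (intro GreatestI_nat[where P = "\<lambda>h. subtree_size q h \<le> s" and k = 0 and b = d]) auto
    have "\<not> subtree_size q (Suc h) \<le> s"
    proof
      assume "subtree_size q (Suc h) \<le> s"
      then have "Suc h \<le> h"
        unfolding h_def using bound
        by (intro Greatest_le_nat[where P = "\<lambda>h. subtree_size q h \<le> s" and b = d]) auto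
      then show False by simp
    qed
    then have sh: "s \<le> q * subtree_size q h" by (simp add: subtree_size_Suc)
    have hd: "h \<le> d" using bound hs by blast
    have h1: "1 \<le> h" using sh 3(1) by (cases h) auto
    define l where "l = (LEAST l. 1 \<le> l \<and> h \<le> q ^ (l + 2))"
    have ex: "1 \<le> h \<and> h \<le> q ^ (h + 2)" using h1 less_pow[of "h + 2"] by simp
    have l: "1 \<le> l" "h \<le> q ^ (l + 2)" "l \<le> h"
      using LeastI[of "\<lambda>l. 1 \<le> l \<and> h \<le> q ^ (l + 2)", OF ex]
        Least_le[of "\<lambda>l. 1 \<le> l \<and> h \<le> q ^ (l + 2)", OF ex] unfolding l_def by auto
    \<comment> \<open>If the room were missing, then h < l + 2 t_l \<le> l + q^l < q^(l+1), so
      \<open>l - 1\<close> would already satisfy the bound defining \<open>l\<close>, unless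
      \<open>l = 1\<close>.\<close>
    have "l = 1 \<or> l + 2 * subtree_size q l \<le> h"
    proof (rule disjCI)
      assume "\<not> l + 2 * subtree_size q l \<le> h"
      moreover have "2 * subtree_size q l \<le> q ^ l"
      proof -
        have "2 * int (subtree_size q l) \<le> (int q - 1) * int (subtree_size q l)"
          using q3 by (intro mult_right_mono) auto
        then have "2 * int (subtree_size q l) \<le> int (q ^ l)"
          unfolding subtree_size_closed by simp
        then show ?thesis by linarith
      qed
      moreover have "2 * q ^ l \<le> q ^ (l + 1)" using q3 by simp
      ultimately have "h < q ^ (l + 1)" using less_pow[of l] by linarith
      then have "h \<le> q ^ (l - 1 + 2)" using l(1) by (simp add: Suc_diff_Suc numeral_2_eq_2)
      then have "\<not> 1 \<le> l - 1"
        using not_less_Least[of "l - 1" "\<lambda>l. 1 \<le> l \<and> h \<le> q ^ (l + 2)"] l(1) unfolding l_def[symmetric]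
        by auto
      then show "l = 1" using l(1) by simp
    qed
    then have "realizable (int s) (h - l + 1)"
      using realizable_from_height[OF q hd l(1,3) _ hs sh] by blast
    moreover have "d \<le> q ^ (d + 3 - (h - l + 1))"
    proof -
      \<comment> \<open>Sizes of smaller height \<open>h\<close> are no worse: the
        \<open>d - h\<close> heights saved outweigh the weaker logarithm, as d \<le> h (1 + d -
        h).\<close>
      have "1 * (d - h) \<le> h * (d - h)" using h1 by (rule mult_right_mono) simp
      then have "d \<le> h * (1 + (d - h))" using hd unfolding distrib_left by linarith
      also have "\<dots> \<le> q ^ (l + 2) * q ^ (d - h)"
        using l(2) less_pow[of "d - h"] by (intro mult_le_mono) auto
      also have "\<dots> = q ^ (l + 2 + (d - h))" by (simp only: power_add)
      also have "l + 2 + (d - h) = d + 3 - (h - l + 1)" using hd l by simp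
      finally show ?thesis .
    qed
    moreover have "h - l + 1 \<le> d + 3" using hd by simp
    ultimately show ?thesis by blast
  qed
qed

end

subsection \<open>The levels of a complete tree\<close>

locale rooted_tree = graph G for G :: "('a, 'b) pre_digraph" +
  fixes r :: 'a
  assumes root_in_verts: "r \<in> verts G"
    and unique_apath: "u \<in> verts G \<Longrightarrow> v \<in> verts G \<Longrightarrow> \<exists>!p. apath u p v"
begin

definition root_path :: "'a \<Rightarrow> 'b list" where
  "root_path v = (THE p. apath r p v)"

definition depth :: "'a \<Rightarrow> nat" where
  "depth v = length (root_path v)"

lemma apath_root_path: "v \<in> verts G \<Longrightarrow> apath r (root_path v) v"
  unfolding root_path_def using unique_apath[OF root_in_verts] by (rule theI')

lemma root_path_eq: "apath r p v \<Longrightarrow> root_path v = p"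
  using unique_apath[OF root_in_verts, of v] apath_root_path[of v] awalk_last_in_verts awalkI_apath
  by blast

lemma depth_root: "depth r = 0"
  using root_path_eq[of "[]" r] root_in_verts by (simp add: depth_def apath_Nil_iff)

lemma awalk_cost_unit: "awalk_cost (\<lambda>_. 1) p = real (length p)"
  by (induction p) auto

text \<open>Every walk from the root to \<open>v\<close> contains a path, which by uniqueness is the
  root path. Lengths are compared through arc sets, since the arcs of a path are distinct.\<close>

lemma graph_dist_eq_depth:
  assumes "v \<in> verts G"
  shows "graph_dist G r v = ereal (real (depth v))"
proof (rule antisym)
  have "awalk r (root_path v) v" using apath_root_path[OF assms] by (rule awalkI_apath)
  from min_cost_le_walk_cost[OF this, of "\<lambda>_. 1"]
  show "graph_dist G r v \<le> ereal (real (depth v))"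
    by (simp add: graph_dist_def awalk_cost_unit depth_def)
  have "depth v \<le> length p" if "awalk r p v" for p
  proof -
    have "apath r (awalk_to_apath p) v" using that by (rule apath_awalk_to_apath)
    then have "root_path v = awalk_to_apath p" by (rule root_path_eq)
    moreover have "distinct (root_path v)"
      using apath_root_path[OF assms] distinct_verts_imp_distinct by (auto simp: apath_def)
    ultimately have "depth v = card (set (awalk_to_apath p))"
      by (simp add: depth_def distinct_card)
    also have "\<dots> \<le> card (set p)"
      using awalk_to_apath_subset[OF that] by (intro card_mono) auto
    also have "\<dots> \<le> length p" by (rule card_length)
    finally show ?thesis .
  qed
  then show "ereal (real (depth v)) \<le> graph_dist G r v"
    unfolding graph_dist_def \<mu>_def by (intro INF_greatest) (auto simp: awalk_cost_unit)
qed

lemma neighborhood_sym: "u \<in> neighborhood G v \<longleftrightarrow> v \<in> neighborhood G u"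
  unfolding neighborhood_def using sym_arcs by (auto simp: symmetric_def sym_def)

lemma neighborhood_in_verts: "u \<in> neighborhood G v \<Longrightarrow> u \<in> verts G \<and> v \<in> verts G"
  unfolding neighborhood_def using adj_in_verts by auto

lemma arc_exists:
  assumes "u \<in> neighborhood G v"
  obtains e where "e \<in> arcs G" "tail G e = v" "head G e = u"
  using assms unfolding neighborhood_def arcs_ends_def arc_to_ends_def by auto

text \<open>If \<open>u\<close> is off the root path of \<open>v\<close>, the edge prolongs that
  path to \<open>u\<close>. Otherwise the part up to \<open>u\<close> avoids \<open>v\<close>, and
  prolonging it gives the root path of \<open>v\<close>. Recording the tail of the last arc makes
  the parent readable from the path.\<close>

lemma adjacent_cases:
  assumes "u \<in> neighborhood G v"
  shows "(\<exists>e. root_path u = root_path v @ [e] \<and> tail G e = v) \<or> (\<exists>e. root_path v = root_path u @ [e] \<and> tail G e = u)"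
proof -
  obtain e where e: "e \<in> arcs G" "tail G e = v" "head G e = u" using arc_exists[OF assms] .
  obtain e' where e': "e' \<in> arcs G" "tail G e' = u" "head G e' = v"
    using arc_exists neighborhood_sym assms by metis
  have uv: "u \<noteq> v" using no_loops[OF e(1)] e by simp
  have v: "v \<in> verts G" and u: "u \<in> verts G" using neighborhood_in_verts[OF assms] by auto
  have path: "apath r (root_path v) v" using apath_root_path[OF v] .
  show ?thesis
  proof (cases "u \<in> set (awalk_verts r (root_path v))")
    case False
    have "apath r (root_path v @ [e]) u"
      using path e False uv u v unfolding apath_append_iff
      by (auto simp: apath_def awalk_Cons_iff awalk_Nil_iff)
    then show ?thesis using root_path_eq e(2) by blast
  next
    case True
    obtain p1 p2 where p: "root_path v = p1 @ p2" "awalk r p1 u" "awalk u p2 v"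
      using awalk_decomp[OF awalkI_apath[OF path] True] by blast
    have "p2 \<noteq> []" using p(3) uv by (auto simp: awalk_Nil_iff)
    have ends: "awlast r p1 = u" using p(2) by auto
    have *: "apath r p1 u" "apath u p2 v"
      "set (awalk_verts r p1) \<inter> set (tl (awalk_verts u p2)) = {}"
      using path unfolding p(1) apath_append_iff ends by auto
    have "v \<in> set (tl (awalk_verts u p2))"
      using p(3) \<open>p2 \<noteq> []\<close> by (cases p2) (auto simp: awalk_Cons_iff)
    then have "v \<notin> set (awalk_verts r p1)" using * by blast
    then have "apath r (p1 @ [e']) v"
      using * e' uv u v ends unfolding apath_append_iff
      by (auto simp: apath_Cons_iff apath_Nil_iff)
    then show ?thesis using root_path_eq * e'(2) by metis
  qed
qed

lemma in_children_iff:
  "w \<in> children G r v \<longleftrightarrow> w \<in> neighborhood G v \<and> depth w = Suc (depth v)"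
  using neighborhood_in_verts[of w v]
  by (auto simp: children_def graph_dist_eq_depth one_ereal_def)

lemma neighborhood_iff_children:
  "u \<in> neighborhood G v \<longleftrightarrow> u \<in> children G r v \<or> v \<in> children G r u"
  using adjacent_cases[of u v] neighborhood_sym[of u v] in_children_iff by (auto simp: depth_def)

lemma parent_unique:
  assumes "w \<in> children G r u" and "w \<in> children G r v"
  shows "u = v"
proof -
  have "\<exists>e. root_path w = root_path x @ [e] \<and> tail G e = x" if "w \<in> children G r x" for x
    using adjacent_cases[of w x] that in_children_iff[of w x] by (auto simp: depth_def)
  from this[OF assms(1)] this[OF assms(2)] show ?thesis by auto
qed

lemma parent_exists:
  assumes "w \<in> verts G" and "depth w = Suc n"
  obtains v where "w \<in> children G r v" "v \<in> verts G" "depth v = n"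
proof -
  obtain p e where p: "root_path w = p @ [e]"
    using assms(2) unfolding depth_def by (metis length_Suc_conv_rev)
  have "apath r (p @ [e]) w" using apath_root_path[OF assms(1)] p by simp
  then have path: "apath r p (tail G e)" and e: "e \<in> arcs G" "head G e = w"
    unfolding apath_append_iff by (auto simp: apath_Cons_iff apath_Nil_iff)
  have "depth (tail G e) = n"
    using root_path_eq[OF path] p assms(2) by (simp add: depth_def)
  moreover have "w \<in> neighborhood G (tail G e)"
    using e in_arcs_imp_in_arcs_ends unfolding neighborhood_def by fastforce
  ultimately show ?thesis using that[of "tail G e"] e in_children_iff assms(2) by auto
qed

end

lemma complete_tree_leveled:
  assumes "complete_tree q d G r"
  shows "\<exists>L. leveled_tree q d G L (children G r)"
proof -
  have "is_tree G" using assms by (simp add: complete_tree_def)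
  then interpret graph G by (simp add: is_tree_def)
  interpret rooted_tree G r
    using assms by unfold_locales (auto simp: complete_tree_def is_tree_def)
  have inner: "card (children G r v) = q" if "v \<in> verts G" "depth v < d" for v
    using assms that graph_dist_eq_depth by (simp add: complete_tree_def)
  have leaf: "children G r v = {}" if "v \<in> verts G" "depth v = d" for v
    using assms that graph_dist_eq_depth by (simp add: complete_tree_def)
  \<comment> \<open>A deeper vertex would have an ancestor at depth \<open>Suc d\<close>, whose
    parent at depth \<open>d\<close> would not be a leaf.\<close>
  have depth_le: "depth v \<le> d" if "v \<in> verts G" for v
  proof (rule ccontr)
    assume "\<not> depth v \<le> d"
    then have "d < depth v" by simp
    have "\<exists>w\<in>verts G. depth w = m" if "m \<le> depth v" for m
      using that
    proof (induction rule: inc_induct)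
      case base
      then show ?case using \<open>v \<in> verts G\<close> by blast
    next
      case (step n)
      then show ?case using parent_exists by metis
    qed
    from this[of "Suc d"] \<open>d < depth v\<close>
    obtain w where "w \<in> verts G" "depth w = Suc d" by auto
    then obtain u where "w \<in> children G r u" "u \<in> verts G" "depth u = d"
      by (rule parent_exists)
    then show False using leaf by blast
  qed
  define L where "L i = {v \<in> verts G. depth v + i = d}" for i
  have ch: "v \<in> verts G" "w \<in> verts G" "depth w = Suc (depth v)" if "w \<in> children G r v" for v w
    using that neighborhood_in_verts in_children_iff by blast+
  have "leveled_tree q d G L (children G r)"
  proof
    show "finite (verts G)" by simp
    show "verts G = (\<Union>i\<le>d. L i)"
    proof
      show "verts G \<subseteq> (\<Union>i\<le>d. L i)"
      proof
        fix v assume "v \<in> verts G"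
        then have "v \<in> L (d - depth v)" using depth_le by (simp add: L_def)
        then show "v \<in> (\<Union>i\<le>d. L i)" by auto
      qed
    qed (auto simp: L_def)
    show "L i \<inter> L j = {}" if "i \<noteq> j" for i j using that by (auto simp: L_def)
    have "L d = {r}"
    proof (intro equalityI subsetI)
      fix v assume "v \<in> L d"
      then have "v \<in> verts G" "root_path v = []" by (auto simp: L_def depth_def)
      then have "apath r [] v" using apath_root_path by metis
      then show "v \<in> {r}" by (simp add: apath_Nil_iff)
    qed (use depth_root root_in_verts in \<open>auto simp: L_def\<close>)
    then show "card (L d) = 1" by simp
    show "card (children G r v) = q" if "v \<in> L (Suc i)" for v i
      using inner that by (auto simp: L_def)
    show "(\<Union>v\<in>L (Suc i). children G r v) = L i" if "i < d" for i
    proof (intro equalityI subsetI)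
      fix w assume "w \<in> (\<Union>v\<in>L (Suc i). children G r v)"
      then show "w \<in> L i" using ch by (fastforce simp: L_def)
    next
      fix w assume w: "w \<in> L i"
      then have "depth w = Suc (d - Suc i)" "w \<in> verts G" using that by (auto simp: L_def)
      then obtain v where "w \<in> children G r v" "v \<in> verts G" "depth v = d - Suc i"
        using parent_exists by metis
      then show "w \<in> (\<Union>v\<in>L (Suc i). children G r v)" using that by (auto simp: L_def)
    qed
    show "children G r u \<inter> children G r v = {}" if "u \<noteq> v" for u v
      using parent_unique that by blast
    show "children G r v = {}" if "v \<in> L 0" for v
      using leaf that by (auto simp: L_def)
    show "u \<in> neighborhood G v \<longleftrightarrow> u \<in> children G r v \<or> v \<in> children G r u" for u v
      by (rule neighborhood_iff_children)
  qed
  then show ?thesis by blast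
qed

section \<open>Bounds on the isoperimetric peak\<close>

lemma vertex_isoperimetric_le:
  assumes "finite (verts G)" and "S \<subseteq> verts G"
  shows "vertex_isoperimetric G (card S) \<le> card (vertex_border G S)"
proof -
  have "finite {S'. S' \<subseteq> verts G \<and> card S' = card S}"
    using assms(1) by (auto intro: finite_subset[of _ "Pow (verts G)"])
  then show ?thesis unfolding vertex_isoperimetric_def using assms(2) by (intro Min_le) auto
qed

lemma vertex_isoperimetric_attained:
  assumes "finite (verts G)" and "s \<le> card (verts G)"
  obtains S where "S \<subseteq> verts G" "card S = s" "vertex_isoperimetric G s = card (vertex_border G S)"
proof -
  let ?F = "{S. S \<subseteq> verts G \<and> card S = s}"
  have "finite ?F" using assms(1) by (auto intro: finite_subset[of _ "Pow (verts G)"])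
  moreover have "?F \<noteq> {}" using assms(2) by (metis (mono_tags, lifting) empty_Collect_eq obtain_subset_with_card_n)
  ultimately have "vertex_isoperimetric G s \<in> (\<lambda>S. card (vertex_border G S)) ` ?F"
    unfolding vertex_isoperimetric_def by (intro Min_in) auto
  then show ?thesis using that by blast
qed

context leveled_tree
begin

lemma peak_attained:
  obtains s where "s \<le> card (verts G)" "vertex_isoperimetric_peak G = vertex_isoperimetric G s"
proof -
  have "vertex_isoperimetric_peak G \<in> vertex_isoperimetric G ` {0..card (verts G)}"
    unfolding vertex_isoperimetric_peak_def by (intro Max_in) auto
  then show ?thesis using that by auto
qed

lemma peak_le:
  assumes q: "q \<in> {3, 4}" and d: "1 \<le> d"
  shows "real (vertex_isoperimetric_peak G) \<le> real d - log (real q) (real d) + 3"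
proof -
  obtain s where s: "s \<le> card (verts G)" "vertex_isoperimetric_peak G = vertex_isoperimetric G s"
    using peak_attained .
  obtain k where k: "k \<le> d + 3" "realizable (int s) k" "d \<le> q ^ (d + 3 - k)"
    using realizable_all[OF q s(1)] by blast
  then obtain S where S: "S \<subseteq> verts G" "card S = s" "card (vertex_border G S) \<le> k"
    unfolding realizable_def by auto
  have "vertex_isoperimetric_peak G \<le> k"
    using vertex_isoperimetric_le[OF finite_verts S(1)] S s(2) by simp
  moreover have "log (real q) (real d) \<le> real (d + 3 - k)"
  proof -
    have "real d \<le> real q ^ (d + 3 - k)" using k(3) by (metis of_nat_le_iff of_nat_power)
    then have "log (real q) (real d) \<le> log (real q) (real q ^ (d + 3 - k))"
      using q d by (intro log_mono) auto
    also have "\<dots> = real (d + 3 - k)" using q by (subst log_pow_cancel) auto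
    finally show ?thesis .
  qed
  ultimately show ?thesis using k(1) by simp
qed

lemma peak_ge:
  assumes q: "3 \<le> q" and j: "1 \<le> j" "j \<le> d" and big: "(q + 1) * (d - j + 1) \<le> q ^ j"
  shows "d - j + 1 \<le> vertex_isoperimetric_peak G"
proof -
  define k where "k = d - j"
  define m where "m = Suc d - j"
  define X where "X = int q ^ j * int (subtree_size q m) + int k"
  \<comment> \<open>The quotient X / (q - 1) rounded up, so that \<open>(q - 1) * s\<close> falls
    into the window of \<open>border_ge\<close>.\<close>
  define s where "s = nat ((X + int q - 2) div (int q - 1))"
  have Q: "int q - 1 > 0" "int q \<ge> 3" using q by auto
  have X: "X \<ge> 0" by (simp add: X_def)
  have "0 \<le> (X + int q - 2) div (int q - 1)"
    using X Q by (intro pos_imp_zdiv_nonneg_iff[THEN iffD2]) auto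
  then have s: "int s = (X + int q - 2) div (int q - 1)" by (simp add: s_def)
  have "(int q - 1) * int s + (X + int q - 2) mod (int q - 1) = X + int q - 2"
    unfolding s by (rule mult_div_mod_eq)
  moreover have "0 \<le> (X + int q - 2) mod (int q - 1)" "(X + int q - 2) mod (int q - 1) < int q - 1"
    using Q by auto
  ultimately have lo: "X \<le> (int q - 1) * int s" and hi: "(int q - 1) * int s \<le> X + int q - 2"
    by linarith+
  have "s \<le> card (verts G)"
  proof -
    have "int ((q + 1) * (k + 1)) \<le> int (q ^ j)" using big unfolding k_def by (simp only: of_nat_le_iff)
    then have big': "int q * int k + int k + int q + 1 \<le> int q ^ j" by (simp add: algebra_simps)
    have R: "2 * int (subtree_size q m) + 1 \<le> int q ^ m"
    proof -
      have "2 * int (subtree_size q m) \<le> (int q - 1) * int (subtree_size q m)"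
        using Q by (intro mult_right_mono) auto
      then show ?thesis unfolding subtree_size_closed by simp
    qed
    have "m \<ge> 1" using j by (simp add: m_def)
    then have "int q ^ 1 \<le> int q ^ m" using Q by (intro power_increasing) auto
    then have "int (subtree_size q m) + 1 \<le> int q ^ m - 1"
      using R Q unfolding power_one_right by linarith
    then have "int q ^ j * (int (subtree_size q m) + 1) \<le> int q ^ j * (int q ^ m - 1)"
      using Q by (intro mult_left_mono) auto
    also have "\<dots> = int q ^ Suc d - int q ^ j"
      using j by (simp add: m_def right_diff_distrib flip: power_add)
    finally have "X + int q - 2 \<le> int q ^ Suc d - 1"
      using big' Q unfolding X_def by (simp add: distrib_left) (smt (verit) mult_nonneg_nonneg of_nat_0_le_iff)
    then have "(int q - 1) * int s \<le> (int q - 1) * int (card (verts G))"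
      using hi unfolding card_verts subtree_size_closed by linarith
    then show ?thesis using Q by simp
  qed
  then obtain S where S: "S \<subseteq> verts G" "card S = s" "vertex_isoperimetric G s = card (vertex_border G S)"
    using vertex_isoperimetric_attained[OF finite_verts] by metis
  have "k < card (vertex_border G S)"
    using big lo hi j unfolding k_def X_def m_def
    by (intro border_ge[OF q j(2) S(1)]) (auto simp: S(2))
  also have "\<dots> \<le> vertex_isoperimetric_peak G"
    unfolding vertex_isoperimetric_peak_def S(3)[symmetric] using \<open>s \<le> _\<close> by (intro Max_ge) auto
  finally show ?thesis by (simp add: k_def)
qed

lemma peak_ge_real:
  assumes q: "3 \<le> q" and d: "1 \<le> d"
  shows "real d - log (real q) (real d) - 1 - log (real q) 2 \<le> real (vertex_isoperimetric_peak G)"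
proof -
  \<comment> \<open>The factor \<open>2 * q\<close> dominates \<open>q + 1\<close> in the hypothesis
    of \<open>peak_ge\<close>; minimality of \<open>j\<close> yields the loss 1 + log_q 2 + log_q
    d.\<close>
  define j where "j = (LEAST j. 2 * q * d < q ^ j)"
  have "2 * q * d < q ^ (2 * q * d)" using q by (intro power_gt_expt) auto
  then have j: "2 * q * d < q ^ j" unfolding j_def by (rule LeastI)
  have j1: "1 \<le> j" using j d q by (cases j) auto
  have "\<not> 2 * q * d < q ^ (j - 1)"
    unfolding j_def using j1 by (intro not_less_Least) (simp add: j_def)
  then have "real q ^ (j - 1) \<le> real (2 * q * d)" by (metis not_less of_nat_le_iff of_nat_power)
  then have "log (real q) (real q ^ (j - 1)) \<le> log (real q) (2 * real q * real d)"
    using q d by (intro log_mono) auto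
  also have "\<dots> = log (real q) 2 + 1 + log (real q) (real d)"
    using q d by (simp add: log_mult)
  finally have *: "real (j - 1) \<le> log (real q) 2 + 1 + log (real q) (real d)"
    using q by (simp add: log_pow_cancel)
  show ?thesis
  proof (cases "j \<le> d")
    case True
    have "(q + 1) * (d - j + 1) \<le> (2 * q) * d"
      using q j1 True by (intro mult_le_mono) auto
    then have "d - j + 1 \<le> vertex_isoperimetric_peak G"
      using j by (intro peak_ge[OF q j1 True]) linarith
    then show ?thesis using * j1 True by (simp add: of_nat_diff)
  next
    case False
    \<comment> \<open>Here the claimed lower bound is at most
      \<open>d - (j - 1) \<le> 0\<close>.\<close>
    then show ?thesis using * j1 by (simp add: of_nat_diff)
  qed
qed

end

theorem theorem1p5:
  fixes T :: "('a, 'b) pre_digraph" and r :: 'a and q d :: nat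
  assumes "q \<in> {3, 4}"
    and "d \<ge> 1"
    and "complete_tree q d T r"
  shows "\<exists>\<epsilon>::real. \<epsilon> \<in> {-1 - log (real q) 2 .. 3} \<and>
    real (vertex_isoperimetric_peak T) = real d - log (real q) (real d) + \<epsilon>"
proof -
  obtain L where "leveled_tree q d T L (children T r)"
    using complete_tree_leveled[OF assms(3)] by blast
  then interpret leveled_tree q d T L "children T r" .
  have "real (vertex_isoperimetric_peak T) \<le> real d - log (real q) (real d) + 3"
    using peak_le[OF assms(1,2)] .
  moreover have "real d - log (real q) (real d) - 1 - log (real q) 2 \<le> real (vertex_isoperimetric_peak T)"
    using assms(1,2) by (intro peak_ge_real) auto
  ultimately show ?thesis
    by (intro exI[of _ "real (vertex_isoperimetric_peak T) - (real d - log (real q) (real d))"]) auto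
qed

end
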